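(* Let $f,\hat f\in L^2(\mathcal X,\mu)$ with $\mathbb V_\mu[f]>0$ and $\mathbb V_\mu[\hat f]>0$, and put $\mathcal E=\|f-\hat f\|_\mu/\mathbb V_\mu^{1/2}[f]$. Let $(S_U,\hat S_U)$ denote either the pair of Sobol' indices of $f$ and $\hat f$ for the subset $U$, or the pair of total-effect indices of $f$ and $\hat f$ for the subset $U$. Then in both cases, for every $U\subseteq\{1,\dots,d\}$, $$|S_U-\hat S_U|\le\min\Big(1,\ \mathcal E+2\sqrt{S_U},\ \mathcal E+2\sqrt{1-S_U}\Big)\cdot\mathcal E.$$ In particular, if $S_U\in\{0,1\}$ for some $U$, then $|S_U-\hat S_U|\le\mathcal E^2$ for that $U$.
   Context: $\mathcal X=\mathcal X_1\times\dots\times\mathcal X_d$ with $\mathcal X_i\subseteq\mathbb R$, and $\mu=\mu_1\otimes\dots\otimes\mu_d$ is a product of probability measures $\mu_i$ on $\mathcal X_i$. $L^2(\mathcal X,\mu)$ is the space of real square-integrable functions, with norm $\|g\|_\mu$; $\mathbb E_\mu,\mathbb V_\mu$ are mean and variance under $\mu$. Every $f\in L^2(\mathcal X,\mu)$ has a unique Sobol-Hoeffding decomposition $f(x)=\sum_{U\subseteq\{1,\dots,d\}}f_U(x_U)$, where $f_U$ depends only on $x_U=(x_i)_{i\in U}$, $f_\emptyset=\mathbb E_\mu[f]$, and $\int_{\mathcal X_i}f_U(x_U)\,d\mu_i(x_i)=0$ for every $i\in U$; its terms are mutually orthogonal. When $\mathbb V_\mu[f]>0$, the Sobol' index of $U$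 is $S_U=\mathbb V_\mu[f_U]/\mathbb V_\mu[f]$ (so $S_\emptyset=0$), and the total-effect index of $U$ is $T_U=\sum_{V:\,V\cap U\ne\emptyset}S_V$ (so $T_\emptyset=0$). Indices of $\hat f$ are denoted with hats. *)

theory Defs
  imports "HOL-Probability.Probability"
begin

text \<open>
  Points of \<open>X 1 \<times> \<dots> \<times> X d\<close> are extensional functions on \<open>{1..d}\<close>, and the subvector of \<open>x\<close>
  indexed by \<open>U\<close> is \<open>restrict x U\<close>. Elements of the \<open>L\<^sup>2\<close> spaces are represented by functions,
  so identities between them are required almost everywhere.
\<close>

definition L2 :: "'a measure \<Rightarrow> ('a \<Rightarrow> real) set" where
  "L2 N = {g \<in> borel_measurable N. integrable N (\<lambda>x. (g x)\<^sup>2)}"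

definition L2_norm :: "'a measure \<Rightarrow> ('a \<Rightarrow> real) \<Rightarrow> real" where
  "L2_norm N g = sqrt (\<integral>x. (g x)\<^sup>2 \<partial>N)"

abbreviation input_measure :: "nat \<Rightarrow> (nat \<Rightarrow> real measure) \<Rightarrow> (nat \<Rightarrow> real) measure" where
  "input_measure d \<mu> \<equiv> Pi\<^sub>M {1..d} \<mu>"

definition is_sobol_hoeffding ::
  "nat \<Rightarrow> (nat \<Rightarrow> real measure) \<Rightarrow> ((nat \<Rightarrow> real) \<Rightarrow> real) \<Rightarrow>
   (nat set \<Rightarrow> (nat \<Rightarrow> real) \<Rightarrow> real) \<Rightarrow> bool" where
  "is_sobol_hoeffding d \<mu> f F \<longleftrightarrow>
     (\<forall>U\<subseteq>{1..d}. F U \<in> L2 (Pi\<^sub>M U \<mu>)) \<and>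
     (AE x in input_measure d \<mu>. f x = (\<Sum>U\<in>Pow {1..d}. F U (restrict x U))) \<and>
     (\<forall>x. F {} (restrict x {}) = prob_space.expectation (input_measure d \<mu>) f) \<and>
     (\<forall>U\<subseteq>{1..d}. \<forall>i\<in>U.
        AE x in Pi\<^sub>M (U - {i}) \<mu>. (\<integral>t. F U (x(i := t)) \<partial>\<mu> i) = 0)"

text \<open>
  The decomposition of a square-integrable function exists and is unique up to null sets,
  so the indices below do not depend on the choice made here.
\<close>

definition sobol_hoeffding ::
  "nat \<Rightarrow> (nat \<Rightarrow> real measure) \<Rightarrow> ((nat \<Rightarrow> real) \<Rightarrow> real) \<Rightarrow>
   nat set \<Rightarrow> (nat \<Rightarrow> real) \<Rightarrow> real" where
  "sobol_hoeffding d \<mu> f = (SOME F. is_sobol_hoeffding d \<mu> f F)"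

definition sobol_index ::
  "nat \<Rightarrow> (nat \<Rightarrow> real measure) \<Rightarrow> ((nat \<Rightarrow> real) \<Rightarrow> real) \<Rightarrow> nat set \<Rightarrow> real" where
  "sobol_index d \<mu> f U =
     prob_space.variance (input_measure d \<mu>) (\<lambda>x. sobol_hoeffding d \<mu> f U (restrict x U)) /
     prob_space.variance (input_measure d \<mu>) f"

definition total_effect_index ::
  "nat \<Rightarrow> (nat \<Rightarrow> real measure) \<Rightarrow> ((nat \<Rightarrow> real) \<Rightarrow> real) \<Rightarrow> nat set \<Rightarrow> real" where
  "total_effect_index d \<mu> f U =
     (\<Sum>V | V \<subseteq> {1..d} \<and> V \<inter> U \<noteq> {}. sobol_index d \<mu> f V)"

definition relative_error ::
  "nat \<Rightarrow> (nat \<Rightarrow> real measure) \<Rightarrow> ((nat \<Rightarrow> real) \<Rightarrow> real) \<Rightarrow> ((nat \<Rightarrow> real) \<Rightarrow> real) \<Rightarrow> real" where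
  "relative_error d \<mu> f g =
     L2_norm (input_measure d \<mu>) (\<lambda>x. f x - g x) /
     sqrt (prob_space.variance (input_measure d \<mu>) f)"

end

theory Submission
  imports Defs
begin

text \<open>
  Write \<open>f\<^sub>U\<close> and \<open>g\<^sub>U\<close> for the Sobol-Hoeffding terms of the two functions. By orthogonality,
  \<open>\<V>[f] = \<Sum>\<^sub>U \<parallel>f\<^sub>U\<parallel>\<^sup>2\<close> over the nonempty \<open>U\<close>, and either index of \<open>f\<close> is the share
  \<open>S = \<Sum>\<^sub>V \<parallel>f\<^sub>V\<parallel>\<^sup>2 / \<V>[f]\<close> in which \<open>V\<close> runs over a family of nonempty sets that does not depend
  on \<open>f\<close> (\<open>sobol_index_eq\<close>, \<open>total_effect_index_eq\<close>). Terms of \<open>f\<close> and of \<open>g\<close> for different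
  sets are orthogonal as well, hence
  \<open>\<parallel>f - g\<parallel>\<^sup>2 = \<Sum>\<^sub>U \<parallel>f\<^sub>U - g\<^sub>U\<parallel>\<^sup>2 \<ge> \<Sum>\<^sub>U (\<parallel>f\<^sub>U\<parallel> - \<parallel>g\<^sub>U\<parallel>)\<^sup>2\<close> (\<open>sum_diff_L2_norm_sobol_term_le\<close>).
  The claim is thus one about two finite vectors of reals, \<open>share_diff_bound\<close>.

  For the vectors, let \<open>T\<close> be the share of \<open>g\<close> and consider the unit vectors
  \<open>(a, b) = (\<surd>S, \<surd>(1 - S))\<close> and \<open>(p, q) = (\<surd>T, \<surd>(1 - T))\<close> of the plane. With \<open>s = a q - b p\<close>,
  the sine of the angle between them, \<open>S - T = s (a q + b p)\<close>, and the second factor is bounded by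
  \<open>1\<close>, by \<open>\<bar>s\<bar> + 2 a\<close> and by \<open>\<bar>s\<bar> + 2 b\<close> (\<open>unit_vectors_square_diff\<close>). Finally \<open>\<bar>s\<bar> \<le> \<E>\<close>:
  collapsing the summands in \<open>V\<close> and those outside to their norms takes the two vectors to
  \<open>\<surd>\<V>[f] (a, b)\<close> and \<open>\<surd>\<V>[g] (p, q)\<close> and does not increase their distance (Cauchy-Schwarz), and
  \<open>\<bar>s\<bar> \<surd>\<V>[f]\<close> is the distance of the first of these to the line through the second.

  The indices are defined by a choice of the decomposition, so its existence has to be proved. Let
  \<open>A\<^sub>i\<close> be the averaging over coordinate \<open>i\<close>. Applying \<open>h = A\<^sub>i h + (h - A\<^sub>i h)\<close> for one
  coordinate after another yields the terms. The operator \<open>A\<^sub>i\<close> is the orthogonal projection onto the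
  square-integrable functions that do not depend on coordinate \<open>i\<close>; therefore \<open>A\<^sub>i h = 0\<close> almost
  everywhere if and only if \<open>h\<close> is orthogonal to all these functions
  (\<open>annihilates_iff_avg_eq_0\<close>). The second form is linear in \<open>h\<close> and is preserved by the other
  averagings, which are self-adjoint; it also gives the orthogonality of the terms at once.
\<close>

section \<open>Square-integrable functions\<close>

lemma L2_D:
  assumes "g \<in> L2 N"
  shows "g \<in> borel_measurable N" "integrable N (\<lambda>x. (g x)\<^sup>2)"
  using assms by (auto simp: L2_def)

lemma integrable_mult_L2:
  assumes "f \<in> L2 N" "g \<in> L2 N"
  shows "integrable N (\<lambda>x. f x * g x)"
proof (rule Bochner_Integration.integrable_bound)
  show "integrable N (\<lambda>x. (f x)\<^sup>2 + (g x)\<^sup>2)"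
    using assms by (auto dest: L2_D)
  show "(\<lambda>x. f x * g x) \<in> borel_measurable N"
    using assms by (intro borel_measurable_times L2_D(1))
  have "\<bar>a * b\<bar> \<le> a\<^sup>2 + b\<^sup>2" for a b :: real
    using sum_squares_bound[of "\<bar>a\<bar>" "\<bar>b\<bar>"] zero_le_power2[of a] zero_le_power2[of b]
    unfolding abs_mult power2_abs by linarith
  then show "AE x in N. norm (f x * g x) \<le> norm ((f x)\<^sup>2 + (g x)\<^sup>2)"
    by simp
qed

lemma L2_cmult: "g \<in> L2 N \<Longrightarrow> (\<lambda>x. c * g x) \<in> L2 N"
  by (auto simp: L2_def power_mult_distrib)

lemma L2_add:
  assumes "f \<in> L2 N" "g \<in> L2 N"
  shows "(\<lambda>x. f x + g x) \<in> L2 N"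
  using assms integrable_mult_L2[OF assms]
  by (auto simp: L2_def power2_sum mult.assoc intro!: Bochner_Integration.integrable_add)

lemma L2_diff:
  assumes "f \<in> L2 N" "g \<in> L2 N"
  shows "(\<lambda>x. f x - g x) \<in> L2 N"
  using L2_add[OF assms(1) L2_cmult[OF assms(2), of "-1"]] by simp

lemma L2_norm_nonneg: "L2_norm N g \<ge> 0"
  by (auto simp: L2_norm_def)

lemma L2_norm_square: "(L2_norm N g)\<^sup>2 = (\<integral>x. (g x)\<^sup>2 \<partial>N)"
  by (auto simp: L2_norm_def)

lemma integral_mult_le_L2_norm:
  assumes f: "f \<in> L2 N" and g: "g \<in> L2 N"
  shows "(\<integral>x. f x * g x \<partial>N) \<le> L2_norm N f * L2_norm N g"
proof -
  define a b where "a = L2_norm N f" and "b = L2_norm N g"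
  have fg: "integrable N (\<lambda>x. f x * g x)"
    using integrable_mult_L2[OF f g] .
  have null: "AE x in N. h x = 0" if "h \<in> L2 N" "L2_norm N h = 0" for h
  proof -
    have "(\<integral>x. (h x)\<^sup>2 \<partial>N) = 0"
      using that(2) L2_norm_square[of N h] by simp
    then show ?thesis
      using L2_D[OF that(1)] by (subst (asm) integral_nonneg_eq_0_iff_AE) auto
  qed
  show ?thesis
  proof (cases "a = 0 \<or> b = 0")
    case True
    then have "AE x in N. f x * g x = 0"
      using null[OF f] null[OF g] by (auto simp: a_def b_def)
    then have "(\<integral>x. f x * g x \<partial>N) = 0"
      by (intro integral_eq_zero_AE)
    then show ?thesis
      by (simp add: L2_norm_nonneg)
  next
    case False
    then have ab: "a * b > 0"
      using L2_norm_nonneg[of N f] L2_norm_nonneg[of N g]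
      by (auto simp: a_def b_def less_le)
    have "0 \<le> (\<integral>x. (b * f x - a * g x)\<^sup>2 \<partial>N)"
      by simp
    also have "\<dots> = (\<integral>x. b\<^sup>2 * (f x)\<^sup>2 + a\<^sup>2 * (g x)\<^sup>2 - 2 * a * b * (f x * g x) \<partial>N)"
      by (intro Bochner_Integration.integral_cong) (auto simp: power2_eq_square algebra_simps)
    also have "\<dots> = b\<^sup>2 * a\<^sup>2 + a\<^sup>2 * b\<^sup>2 - 2 * a * b * (\<integral>x. f x * g x \<partial>N)"
      using fg L2_D[OF f] L2_D[OF g]
      by (simp add: a_def b_def L2_norm_square)
    also have "\<dots> = 2 * (a * b) * (a * b - (\<integral>x. f x * g x \<partial>N))"
      by (simp add: power2_eq_square algebra_simps)
    finally show ?thesis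
      using ab by (simp add: a_def b_def zero_le_mult_iff)
  qed
qed

lemma L2_norm_diff_ge:
  assumes f: "f \<in> L2 N" and g: "g \<in> L2 N"
  shows "(L2_norm N f - L2_norm N g)\<^sup>2 \<le> (\<integral>x. (f x - g x)\<^sup>2 \<partial>N)"
proof -
  have "(\<integral>x. (f x - g x)\<^sup>2 \<partial>N) = (\<integral>x. (f x)\<^sup>2 + (g x)\<^sup>2 - 2 * (f x * g x) \<partial>N)"
    by (intro Bochner_Integration.integral_cong) (auto simp: power2_eq_square algebra_simps)
  also have "\<dots> = (L2_norm N f)\<^sup>2 + (L2_norm N g)\<^sup>2 - 2 * (\<integral>x. f x * g x \<partial>N)"
    using integrable_mult_L2[OF f g] L2_D[OF f] L2_D[OF g] by (simp add: L2_norm_square)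
  finally show ?thesis
    using integral_mult_le_L2_norm[OF f g] by (simp add: power2_diff)
qed

section \<open>Averaging over one coordinate\<close>

context finite_product_prob_space
begin

text \<open>
  The average of \<open>g\<close> over coordinate \<open>i\<close>, as a function of all coordinates. Where the section of
  \<open>g\<close> is not integrable the value is 0 by convention; for integrable \<open>g\<close> this concerns a null set.
\<close>

definition avg :: "'a \<Rightarrow> (('a \<Rightarrow> 'b) \<Rightarrow> real) \<Rightarrow> ('a \<Rightarrow> 'b) \<Rightarrow> real" where
  "avg i g x = (\<integral>t. g (x(i := t)) \<partial>M i)"

lemma fun_upd_in_space:
  assumes "x \<in> space (Pi\<^sub>M I M)" "i \<in> I" "t \<in> space (M i)"
  shows "x(i := t) \<in> space (Pi\<^sub>M I M)"
  using assms by (auto simp: space_PiM PiE_iff extensional_def)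

lemma measurable_resample:
  assumes "i \<in> I"
  shows "(\<lambda>(x, t). x(i := t)) \<in> measurable (Pi\<^sub>M I M \<Otimes>\<^sub>M M i) (Pi\<^sub>M I M)"
  using measurable_add_dim[of i I M] assms by (simp add: insert_absorb)

text \<open>
  Replacing one coordinate by an independent draw from its distribution preserves the product
  measure. This reduces statements on \<open>avg\<close> to Fubini's theorem for a product of two spaces.
\<close>

lemma distr_resample:
  assumes i: "i \<in> I"
  shows "distr (Pi\<^sub>M I M \<Otimes>\<^sub>M M i) (Pi\<^sub>M I M) (\<lambda>(x, t). x(i := t)) = Pi\<^sub>M I M"
proof (rule PiM_eqI)
  fix A assume A: "\<And>j. j \<in> I \<Longrightarrow> A j \<in> sets (M j)"
  define B where "B = A(i := space (M i))"
  have B: "\<And>j. j \<in> I \<Longrightarrow> B j \<in> sets (M j)"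
    using A by (auto simp: B_def)
  have sp: "\<And>j. j \<in> I \<Longrightarrow> A j \<subseteq> space (M j)"
    using A by (blast dest: sets.sets_into_space)
  have "(\<lambda>(x, t). x(i := t)) -` Pi\<^sub>E I A \<inter> space (Pi\<^sub>M I M \<Otimes>\<^sub>M M i) = Pi\<^sub>E I B \<times> A i"
  proof (intro set_eqI iffI; clarsimp simp: space_pair_measure space_PiM)
    fix x t assume *: "x(i := t) \<in> Pi\<^sub>E I A" "x \<in> (\<Pi>\<^sub>E j\<in>I. space (M j))" "t \<in> space (M i)"
    show "x \<in> Pi\<^sub>E I B \<and> t \<in> A i"
      using * i by (auto simp: PiE_iff B_def split: if_splits)
  next
    fix x t assume *: "x \<in> Pi\<^sub>E I B" "t \<in> A i"
    show "x(i := t) \<in> Pi\<^sub>E I A \<and> x \<in> (\<Pi>\<^sub>E j\<in>I. space (M j)) \<and> t \<in> space (M i)"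
      using * i sp by (fastforce simp: PiE_iff B_def extensional_def split: if_splits)
  qed
  then have "emeasure (distr (Pi\<^sub>M I M \<Otimes>\<^sub>M M i) (Pi\<^sub>M I M) (\<lambda>(x, t). x(i := t))) (Pi\<^sub>E I A)
      = emeasure (Pi\<^sub>M I M \<Otimes>\<^sub>M M i) (Pi\<^sub>E I B \<times> A i)"
    using A by (subst emeasure_distr[OF measurable_resample[OF i]]) (auto intro!: sets_PiM_I_finite finite_index)
  also have "\<dots> = emeasure (Pi\<^sub>M I M) (Pi\<^sub>E I B) * emeasure (M i) (A i)"
    using A B i by (intro M.emeasure_pair_measure_Times) (auto intro!: sets_PiM_I_finite finite_index)
  also have "\<dots> = (\<Prod>j\<in>I. emeasure (M j) (B j)) * emeasure (M i) (A i)"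
    using B by (simp add: measure_times)
  also have "\<dots> = (\<Prod>j\<in>I. emeasure (M j) (A j))"
  proof -
    have "(\<Prod>j\<in>I. emeasure (M j) (B j)) = (\<Prod>j\<in>I - {i}. emeasure (M j) (A j))"
      using i by (simp add: prod.remove[OF finite_index i] B_def M.emeasure_space_1)
    then show ?thesis
      using i by (simp add: prod.remove[OF finite_index i] mult.commute)
  qed
  finally show "emeasure (distr (Pi\<^sub>M I M \<Otimes>\<^sub>M M i) (Pi\<^sub>M I M) (\<lambda>(x, t). x(i := t))) (Pi\<^sub>E I A)
      = (\<Prod>j\<in>I. emeasure (M j) (A j))" .
qed (auto intro: finite_index)

lemma
  fixes k :: "('a \<Rightarrow> 'b) \<Rightarrow> real"
  assumes i: "i \<in> I" and k: "integrable (Pi\<^sub>M I M) k"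
  shows integrable_avg: "integrable (Pi\<^sub>M I M) (avg i k)"
    and integral_avg: "(\<integral>x. avg i k x \<partial>Pi\<^sub>M I M) = (\<integral>x. k x \<partial>Pi\<^sub>M I M)"
    and AE_integrable_section: "AE x in Pi\<^sub>M I M. integrable (M i) (\<lambda>t. k (x(i := t)))"
proof -
  interpret P: pair_sigma_finite "Pi\<^sub>M I M" "M i"
    by standard
  have int: "integrable (Pi\<^sub>M I M \<Otimes>\<^sub>M M i) (\<lambda>(x, t). k (x(i := t)))"
    using k integrable_distr_eq[OF measurable_resample[OF i] borel_measurable_integrable[OF k]]
    by (simp add: distr_resample[OF i, unfolded case_prod_unfold] case_prod_unfold)
  show "integrable (Pi\<^sub>M I M) (avg i k)"
    using P.integrable_fst'[OF int] by (simp add: avg_def[abs_def])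
  show "AE x in Pi\<^sub>M I M. integrable (M i) (\<lambda>t. k (x(i := t)))"
    using P.AE_integrable_fst'[OF int] by simp
  have "(\<integral>x. k x \<partial>Pi\<^sub>M I M) = (\<integral>z. (\<lambda>(x, t). k (x(i := t))) z \<partial>(Pi\<^sub>M I M \<Otimes>\<^sub>M M i))"
    using integral_distr[OF measurable_resample[OF i] borel_measurable_integrable[OF k]]
    by (simp add: distr_resample[OF i, unfolded case_prod_unfold] case_prod_unfold)
  then show "(\<integral>x. avg i k x \<partial>Pi\<^sub>M I M) = (\<integral>x. k x \<partial>Pi\<^sub>M I M)"
    using P.integral_fst'[OF int] by (simp add: avg_def[abs_def])
qed

text \<open>
  At almost every point the square of the average is at most the average of the square, because
  their difference is minus a variance.
\<close>

lemma L2_avg: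
  assumes i: "i \<in> I" and g: "g \<in> L2 (Pi\<^sub>M I M)"
  shows "avg i g \<in> L2 (Pi\<^sub>M I M)"
proof -
  have meas: "avg i g \<in> borel_measurable (Pi\<^sub>M I M)"
  proof -
    have "(\<lambda>(x, t). g (x(i := t))) \<in> borel_measurable (Pi\<^sub>M I M \<Otimes>\<^sub>M M i)"
      using measurable_compose[OF measurable_resample[OF i] L2_D(1)[OF g]]
      by (simp add: split_beta)
    then show ?thesis
      unfolding avg_def[abs_def] by (rule M.borel_measurable_lebesgue_integral)
  qed
  have "AE x in Pi\<^sub>M I M. (avg i g x)\<^sup>2 \<le> avg i (\<lambda>x. (g x)\<^sup>2) x"
    using AE_integrable_section[OF i L2_D(2)[OF g]]
  proof (rule AE_mp, intro AE_I2 impI)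
    fix x assume x: "x \<in> space (Pi\<^sub>M I M)" and sq: "integrable (M i) (\<lambda>t. (g (x(i := t)))\<^sup>2)"
    have mx: "(\<lambda>t. g (x(i := t))) \<in> borel_measurable (M i)"
      using measurable_compose[OF measurable_Pair1'[OF x]
          measurable_compose[OF measurable_resample[OF i] L2_D(1)[OF g]]]
      by simp
    have "integrable (M i) (\<lambda>t. g (x(i := t)))"
      using M.square_integrable_imp_integrable[OF mx sq] .
    then show "(avg i g x)\<^sup>2 \<le> avg i (\<lambda>x. (g x)\<^sup>2) x"
      using M.variance_positive[of i "\<lambda>t. g (x(i := t))"] sq
      by (simp add: avg_def M.variance_eq)
  qed
  then have "integrable (Pi\<^sub>M I M) (\<lambda>x. (avg i g x)\<^sup>2)"
    using meas by (intro Bochner_Integration.integrable_bound[OF integrable_avg[OF i L2_D(2)[OF g]]]) auto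
  with meas show ?thesis
    by (simp add: L2_def)
qed

text \<open>
  The value of \<open>g\<close> at a point of the product space depends only on the coordinates in \<open>K\<close>. This is
  an exact condition, without exceptional null set.
\<close>

definition determined_by :: "'a set \<Rightarrow> (('a \<Rightarrow> 'b) \<Rightarrow> real) \<Rightarrow> bool" where
  "determined_by K g \<longleftrightarrow>
     (\<forall>x\<in>space (Pi\<^sub>M I M). \<forall>y\<in>space (Pi\<^sub>M I M). (\<forall>i\<in>K. x i = y i) \<longrightarrow> g x = g y)"

lemma determined_byD:
  "determined_by K g \<Longrightarrow> x \<in> space (Pi\<^sub>M I M) \<Longrightarrow> y \<in> space (Pi\<^sub>M I M) \<Longrightarrow>
     (\<And>i. i \<in> K \<Longrightarrow> x i = y i) \<Longrightarrow> g x = g y"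
  unfolding determined_by_def by blast

lemma determined_by_mono: "determined_by K g \<Longrightarrow> K \<subseteq> K' \<Longrightarrow> determined_by K' g"
  unfolding determined_by_def by blast

lemma determined_by_diff:
  assumes "determined_by K g" "determined_by K h"
  shows "determined_by K (\<lambda>x. g x - h x)"
  unfolding determined_by_def
proof (intro ballI impI)
  fix x y assume "x \<in> space (Pi\<^sub>M I M)" "y \<in> space (Pi\<^sub>M I M)" "\<forall>i\<in>K. x i = y i"
  then show "g x - h x = g y - h y"
    using assms[THEN determined_byD, of x y] by simp
qed

lemma determined_by_avg:
  assumes "i \<in> I" and g: "determined_by K g"
  shows "determined_by (K - {i}) (avg i g)"
  unfolding determined_by_def
proof (intro ballI impI)
  fix x y assume x: "x \<in> space (Pi\<^sub>M I M)" and y: "y \<in> space (Pi\<^sub>M I M)"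
    and eq: "\<forall>j\<in>K - {i}. x j = y j"
  show "avg i g x = avg i g y"
    unfolding avg_def
    by (intro Bochner_Integration.integral_cong refl determined_byD[OF g])
       (use x y eq assms(1) in \<open>auto intro: fun_upd_in_space\<close>)
qed

lemma avg_mult_determined:
  assumes i: "i \<in> I" and h: "determined_by (I - {i}) h" and x: "x \<in> space (Pi\<^sub>M I M)"
  shows "avg i (\<lambda>x. g x * h x) x = avg i g x * h x"
proof -
  have "avg i (\<lambda>x. g x * h x) x = (\<integral>t. g (x(i := t)) * h x \<partial>M i)"
    unfolding avg_def
    by (intro Bochner_Integration.integral_cong refl arg_cong2[where f = "(*)"] determined_byD[OF h])
       (use x i in \<open>auto intro: fun_upd_in_space\<close>)
  then show ?thesis
    by (simp add: avg_def)
qed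

lemma integral_mult_avg:
  assumes i: "i \<in> I" and g: "g \<in> L2 (Pi\<^sub>M I M)" and h: "h \<in> L2 (Pi\<^sub>M I M)"
    and det: "determined_by (I - {i}) h"
  shows "(\<integral>x. avg i g x * h x \<partial>Pi\<^sub>M I M) = (\<integral>x. g x * h x \<partial>Pi\<^sub>M I M)"
proof -
  have "(\<integral>x. g x * h x \<partial>Pi\<^sub>M I M) = (\<integral>x. avg i (\<lambda>x. g x * h x) x \<partial>Pi\<^sub>M I M)"
    using integral_avg[OF i integrable_mult_L2[OF g h]] by simp
  also have "\<dots> = (\<integral>x. avg i g x * h x \<partial>Pi\<^sub>M I M)"
    by (intro Bochner_Integration.integral_cong refl avg_mult_determined[OF i det])
  finally show ?thesis ..
qed


lemma determined_by_UNIV: "determined_by I g"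
  unfolding determined_by_def space_PiM using PiE_ext[of _ I "\<lambda>i. space (M i)"] by metis

lemma determined_by_avg': "i \<in> I \<Longrightarrow> determined_by (I - {i}) (avg i g)"
  by (intro determined_by_avg determined_by_UNIV)

lemma integral_avg_mult_commute:
  assumes i: "i \<in> I" and g: "g \<in> L2 (Pi\<^sub>M I M)" and h: "h \<in> L2 (Pi\<^sub>M I M)"
  shows "(\<integral>x. avg i g x * h x \<partial>Pi\<^sub>M I M) = (\<integral>x. g x * avg i h x \<partial>Pi\<^sub>M I M)"
proof -
  have "(\<integral>x. g x * avg i h x \<partial>Pi\<^sub>M I M) = (\<integral>x. avg i g x * avg i h x \<partial>Pi\<^sub>M I M)"
    using integral_mult_avg[OF i g L2_avg[OF i h] determined_by_avg'[OF i]] by simp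
  also have "\<dots> = (\<integral>x. avg i g x * h x \<partial>Pi\<^sub>M I M)"
    using integral_mult_avg[OF i h L2_avg[OF i g] determined_by_avg'[OF i]]
    by (simp add: mult.commute)
  finally show ?thesis ..
qed

section \<open>Pure interaction terms\<close>

text \<open>
  Orthogonality to all square-integrable functions that do not depend on coordinate \<open>i\<close>. For
  square-integrable \<open>g\<close> this says that the integral of \<open>g\<close> over coordinate \<open>i\<close> vanishes almost
  everywhere.
\<close>

definition annihilates :: "'a \<Rightarrow> (('a \<Rightarrow> 'b) \<Rightarrow> real) \<Rightarrow> bool" where
  "annihilates i g \<longleftrightarrow>
     (\<forall>h\<in>L2 (Pi\<^sub>M I M). determined_by (I - {i}) h \<longrightarrow> (\<integral>x. g x * h x \<partial>Pi\<^sub>M I M) = 0)"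

text \<open>
  Square-integrable functions of the coordinates in \<open>U\<close> that have mean zero in each of these
  coordinates: the possible terms with index \<open>U\<close> of a Sobol-Hoeffding decomposition, regarded as
  functions on the whole product.
\<close>

definition pure :: "'a set \<Rightarrow> (('a \<Rightarrow> 'b) \<Rightarrow> real) \<Rightarrow> bool" where
  "pure U g \<longleftrightarrow> g \<in> L2 (Pi\<^sub>M I M) \<and> determined_by U g \<and> (\<forall>i\<in>U. annihilates i g)"

lemma annihilates_diff:
  assumes g: "g \<in> L2 (Pi\<^sub>M I M)" and h: "h \<in> L2 (Pi\<^sub>M I M)"
    and "annihilates i g" "annihilates i h"
  shows "annihilates i (\<lambda>x. g x - h x)"
  unfolding annihilates_def
proof (intro ballI impI)
  fix k assume k: "k \<in> L2 (Pi\<^sub>M I M)" and "determined_by (I - {i}) k"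
  then show "(\<integral>x. (g x - h x) * k x \<partial>Pi\<^sub>M I M) = 0"
    using assms(3,4) integrable_mult_L2[OF g k] integrable_mult_L2[OF h k]
    by (simp add: annihilates_def left_diff_distrib)
qed

lemma annihilates_avg:
  assumes "i \<in> I" "j \<in> I" and g: "g \<in> L2 (Pi\<^sub>M I M)" and ann: "annihilates i g"
  shows "annihilates i (avg j g)"
  unfolding annihilates_def
proof (intro ballI impI)
  fix h assume h: "h \<in> L2 (Pi\<^sub>M I M)" and det: "determined_by (I - {i}) h"
  have "determined_by (I - {i}) (avg j h)"
    using determined_by_avg[OF assms(2) det] by (rule determined_by_mono) auto
  then have "(\<integral>x. g x * avg j h x \<partial>Pi\<^sub>M I M) = 0"
    using ann L2_avg[OF assms(2) h] by (simp add: annihilates_def)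
  then show "(\<integral>x. avg j g x * h x \<partial>Pi\<^sub>M I M) = 0"
    using integral_avg_mult_commute[OF assms(2) g h] by simp
qed

lemma annihilates_diff_avg:
  assumes i: "i \<in> I" and g: "g \<in> L2 (Pi\<^sub>M I M)"
  shows "annihilates i (\<lambda>x. g x - avg i g x)"
  unfolding annihilates_def
proof (intro ballI impI)
  fix h assume h: "h \<in> L2 (Pi\<^sub>M I M)" and det: "determined_by (I - {i}) h"
  show "(\<integral>x. (g x - avg i g x) * h x \<partial>Pi\<^sub>M I M) = 0"
    using integral_mult_avg[OF i g h det] integrable_mult_L2[OF g h]
      integrable_mult_L2[OF L2_avg[OF i g] h]
    by (simp add: left_diff_distrib)
qed

lemma annihilates_iff_avg_eq_0:
  assumes i: "i \<in> I" and g: "g \<in> L2 (Pi\<^sub>M I M)"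
  shows "annihilates i g \<longleftrightarrow> (AE x in Pi\<^sub>M I M. avg i g x = 0)"
proof
  assume "annihilates i g"
  then have "(\<integral>x. g x * avg i g x \<partial>Pi\<^sub>M I M) = 0"
    using determined_by_avg'[OF i] L2_avg[OF i g] by (simp add: annihilates_def)
  then have "(\<integral>x. (avg i g x)\<^sup>2 \<partial>Pi\<^sub>M I M) = 0"
    using integral_mult_avg[OF i g L2_avg[OF i g] determined_by_avg'[OF i]]
    by (simp add: power2_eq_square)
  then show "AE x in Pi\<^sub>M I M. avg i g x = 0"
    using L2_D(2)[OF L2_avg[OF i g]] by (subst (asm) integral_nonneg_eq_0_iff_AE) auto
next
  assume AE0: "AE x in Pi\<^sub>M I M. avg i g x = 0"
  show "annihilates i g"
    unfolding annihilates_def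
  proof (intro ballI impI)
    fix h assume h: "h \<in> L2 (Pi\<^sub>M I M)" and det: "determined_by (I - {i}) h"
    have "(\<integral>x. avg i g x * h x \<partial>Pi\<^sub>M I M) = 0"
      by (rule integral_eq_zero_AE) (use AE0 in auto)
    then show "(\<integral>x. g x * h x \<partial>Pi\<^sub>M I M) = 0"
      using integral_mult_avg[OF i g h det] by simp
  qed
qed

lemma pure_diff: "pure U g \<Longrightarrow> pure U h \<Longrightarrow> pure U (\<lambda>x. g x - h x)"
  by (simp add: pure_def annihilates_diff L2_diff determined_by_diff)

lemma pure_zero: "pure U (\<lambda>x. 0)"
  by (auto simp: pure_def annihilates_def L2_def determined_by_def)

lemma integral_pure_eq_0:
  assumes "pure U g" "U \<noteq> {}"
  shows "(\<integral>x. g x \<partial>Pi\<^sub>M I M) = 0"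
proof -
  obtain i where i: "i \<in> U" "annihilates i g"
    using assms by (auto simp: pure_def)
  have "(\<lambda>x. 1) \<in> L2 (Pi\<^sub>M I M)" "determined_by (I - {i}) (\<lambda>x. 1)"
    by (auto simp: L2_def determined_by_def)
  then have "(\<integral>x. g x * 1 \<partial>Pi\<^sub>M I M) = 0"
    using i(2) unfolding annihilates_def by blast
  then show ?thesis
    by simp
qed

lemma pure_orthogonal:
  assumes "pure U g" "pure V h" "U \<noteq> V" "U \<subseteq> I" "V \<subseteq> I"
  shows "(\<integral>x. g x * h x \<partial>Pi\<^sub>M I M) = 0"
proof -
  have one_sided: "(\<integral>x. g x * h x \<partial>Pi\<^sub>M I M) = 0"
    if "pure U g" "pure V h" "i \<in> U" "i \<notin> V" "V \<subseteq> I" for g h i U V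
  proof -
    have "determined_by (I - {i}) h"
      using that by (auto simp: pure_def intro: determined_by_mono)
    then show ?thesis
      using that by (auto simp: pure_def annihilates_def)
  qed
  show ?thesis
  proof (cases "U \<subseteq> V")
    case True
    then obtain i where "i \<in> V" "i \<notin> U"
      using assms(3) by blast
    then show ?thesis
      using one_sided[OF assms(2,1)] assms(4) by (simp add: mult.commute)
  next
    case False
    then show ?thesis
      using one_sided[OF assms(1,2)] assms(5) by blast
  qed
qed

lemma pure_Parseval:
  assumes pure: "\<And>U. U \<subseteq> I \<Longrightarrow> pure U (G U)"
  shows "(\<integral>x. (\<Sum>U\<in>Pow I. G U x)\<^sup>2 \<partial>Pi\<^sub>M I M) = (\<Sum>U\<in>Pow I. \<integral>x. (G U x)\<^sup>2 \<partial>Pi\<^sub>M I M)"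
proof -
  have int: "integrable (Pi\<^sub>M I M) (\<lambda>x. G U x * G V x)" if "U \<in> Pow I" "V \<in> Pow I" for U V
    using pure that by (auto intro: integrable_mult_L2 simp: pure_def)
  have "(\<integral>x. (\<Sum>U\<in>Pow I. G U x)\<^sup>2 \<partial>Pi\<^sub>M I M)
      = (\<integral>x. (\<Sum>U\<in>Pow I. \<Sum>V\<in>Pow I. G U x * G V x) \<partial>Pi\<^sub>M I M)"
    by (simp add: power2_eq_square sum_product)
  also have "\<dots> = (\<Sum>U\<in>Pow I. \<Sum>V\<in>Pow I. \<integral>x. G U x * G V x \<partial>Pi\<^sub>M I M)"
    using int by (subst Bochner_Integration.integral_sum)
      (auto intro!: sum.cong Bochner_Integration.integral_sum Bochner_Integration.integrable_sum)
  also have "\<dots> = (\<Sum>U\<in>Pow I. \<Sum>V\<in>Pow I. if V = U then \<integral>x. (G U x)\<^sup>2 \<partial>Pi\<^sub>M I M else 0)"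
    using pure_orthogonal[OF pure pure] by (intro sum.cong refl) (auto simp: power2_eq_square)
  also have "\<dots> = (\<Sum>U\<in>Pow I. \<integral>x. (G U x)\<^sup>2 \<partial>Pi\<^sub>M I M)"
    using finite_index by (intro sum.cong refl) (simp add: sum.delta)
  finally show ?thesis .
qed

text \<open>
  The decomposition with respect to the coordinates in \<open>J\<close> only: the term with index \<open>U\<close> may depend
  on \<open>U\<close> and on all coordinates outside \<open>J\<close>.
\<close>

lemma partial_decomposition:
  assumes "finite J" "J \<subseteq> I" and f: "f \<in> L2 (Pi\<^sub>M I M)"
  shows "\<exists>G. (\<forall>U\<subseteq>J. G U \<in> L2 (Pi\<^sub>M I M) \<and> determined_by (I - (J - U)) (G U) \<and>
                      (\<forall>i\<in>U. annihilates i (G U))) \<and>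
             (\<forall>x. f x = (\<Sum>U\<in>Pow J. G U x))"
  using assms(1,2)
proof (induction J rule: finite_induct)
  case empty
  then show ?case
    using f determined_by_UNIV by (intro exI[of _ "\<lambda>U. f"]) auto
next
  case (insert j J)
  then have j: "j \<in> I" and J: "J \<subseteq> I"
    by auto
  obtain G where *: "\<forall>U\<subseteq>J. G U \<in> L2 (Pi\<^sub>M I M) \<and> determined_by (I - (J - U)) (G U) \<and>
      (\<forall>i\<in>U. annihilates i (G U))" and f_eq: "\<forall>x. f x = (\<Sum>U\<in>Pow J. G U x)"
    using insert.IH[OF J] by blast
  have G: "G U \<in> L2 (Pi\<^sub>M I M)" "determined_by (I - (J - U)) (G U)"
    "\<And>i. i \<in> U \<Longrightarrow> annihilates i (G U)" if "U \<subseteq> J" for U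
    using * that by blast+
  \<comment> \<open>Each \<open>G U\<close> splits into its average over coordinate \<open>j\<close>, which stays at index \<open>U\<close>, and
    the remainder, which moves to index \<open>insert j U\<close>.\<close>
  define G' where "G' U = (if j \<in> U then \<lambda>x. G (U - {j}) x - avg j (G (U - {j})) x
      else avg j (G U))" for U
  have "G' U \<in> L2 (Pi\<^sub>M I M) \<and> determined_by (I - (insert j J - U)) (G' U) \<and>
      (\<forall>i\<in>U. annihilates i (G' U))"
    if U: "U \<subseteq> insert j J" for U
  proof (cases "j \<in> U")
    case True
    define V where "V = U - {j}"
    have V: "V \<subseteq> J" and eq: "insert j J - U = J - V"
      using U True insert.hyps by (auto simp: V_def)
    have G'U: "G' U = (\<lambda>x. G V x - avg j (G V) x)"
      using True by (simp add: G'_def V_def)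
    note avgL2 = L2_avg[OF j G(1)[OF V]]
    have "determined_by (I - (J - V)) (avg j (G V))"
      using determined_by_avg[OF j G(2)[OF V]] by (rule determined_by_mono) auto
    then have "determined_by (I - (J - V)) (G' U)"
      using determined_by_diff[OF G(2)[OF V]] by (simp add: G'U)
    moreover have "annihilates i (G' U)" if "i \<in> U" for i
    proof (cases "i = j")
      case True
      then show ?thesis
        using annihilates_diff_avg[OF j G(1)[OF V]] by (simp add: G'U)
    next
      case False
      then have i: "i \<in> V" "i \<in> I"
        using that V J by (auto simp: V_def)
      then show ?thesis
        using annihilates_diff[OF G(1)[OF V] avgL2 G(3)[OF V i(1)]
            annihilates_avg[OF i(2) j G(1)[OF V] G(3)[OF V i(1)]]]
        by (simp add: G'U)
    qed
    ultimately show ?thesis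
      using L2_diff[OF G(1)[OF V] avgL2] by (simp add: eq G'U)
  next
    case False
    then have V: "U \<subseteq> J" and eq: "I - (insert j J - U) = I - (J - U) - {j}"
      using U by auto
    have "annihilates i (avg j (G U))" if "i \<in> U" for i
      using that V J by (intro annihilates_avg[OF _ j G(1)[OF V] G(3)[OF V that]]) auto
    then show ?thesis
      using False L2_avg[OF j G(1)[OF V]] determined_by_avg[OF j G(2)[OF V]]
      by (simp add: G'_def eq)
  qed
  moreover have "f x = (\<Sum>U\<in>Pow (insert j J). G' U x)" for x
  proof -
    have nj: "j \<notin> U" if "U \<in> Pow J" for U
      using that insert.hyps by auto
    have "(\<Sum>U\<in>Pow (insert j J). G' U x)
        = (\<Sum>U\<in>Pow J. G' U x) + (\<Sum>U\<in>insert j ` Pow J. G' U x)"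
      unfolding Pow_insert using insert.hyps
      by (intro sum.union_disjoint) auto
    also have "(\<Sum>U\<in>insert j ` Pow J. G' U x) = (\<Sum>U\<in>Pow J. G' (insert j U) x)"
      using insert.hyps by (subst sum.reindex) (auto simp: inj_on_def)
    also have "(\<Sum>U\<in>Pow J. G' U x) + \<dots> = (\<Sum>U\<in>Pow J. G' U x + G' (insert j U) x)"
      by (simp add: sum.distrib)
    also have "\<dots> = (\<Sum>U\<in>Pow J. G U x)"
      using nj by (intro sum.cong refl) (simp add: G'_def)
    finally show ?thesis
      by (simp add: f_eq)
  qed
  ultimately show ?case
    by blast
qed

lemma pure_decomposition:
  assumes f: "f \<in> L2 (Pi\<^sub>M I M)"
  obtains G where "\<And>U. U \<subseteq> I \<Longrightarrow> pure U (G U)" "\<And>x. f x = (\<Sum>U\<in>Pow I. G U x)"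
proof -
  obtain G where G: "\<forall>U\<subseteq>I. G U \<in> L2 (Pi\<^sub>M I M) \<and> determined_by (I - (I - U)) (G U) \<and>
                      (\<forall>i\<in>U. annihilates i (G U))" "\<forall>x. f x = (\<Sum>U\<in>Pow I. G U x)"
    using partial_decomposition[OF finite_index order_refl f] by blast
  have "pure U (G U)" if "U \<subseteq> I" for U
    using G(1) that by (simp add: pure_def double_diff)
  then show ?thesis
    using that G(2) by blast
qed

section \<open>Functions of a subvector\<close>

lemma measurable_restrict_PiM: "U \<subseteq> I \<Longrightarrow> (\<lambda>x. restrict x U) \<in> measurable (Pi\<^sub>M I M) (Pi\<^sub>M U M)"
  by (rule measurable_restrict_subset)

lemma distr_restrict_PiM:
  "U \<subseteq> I \<Longrightarrow> distr (Pi\<^sub>M I M) (Pi\<^sub>M U M) (\<lambda>x. restrict x U) = Pi\<^sub>M U M"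
  using distr_restrict[of U I] finite_index by simp

lemma L2_restrict_iff:
  assumes U: "U \<subseteq> I" and F: "F \<in> borel_measurable (Pi\<^sub>M U M)"
  shows "(\<lambda>x. F (restrict x U)) \<in> L2 (Pi\<^sub>M I M) \<longleftrightarrow> F \<in> L2 (Pi\<^sub>M U M)"
  using integrable_distr_eq[OF measurable_restrict_PiM[OF U], of "\<lambda>y. (F y)\<^sup>2"] F
    measurable_compose[OF measurable_restrict_PiM[OF U] F]
  by (simp add: L2_def distr_restrict_PiM[OF U])

lemma restrict_fun_upd_member: "i \<in> U \<Longrightarrow> restrict (x(i := t)) U = (restrict x (U - {i}))(i := t)"
  by (auto simp: fun_eq_iff)

lemma AE_section_iff:
  assumes U: "U \<subseteq> I" "i \<in> U" and F: "F \<in> borel_measurable (Pi\<^sub>M U M)"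
  shows "(AE x in Pi\<^sub>M (U - {i}) M. (\<integral>t. F (x(i := t)) \<partial>M i) = 0)
     \<longleftrightarrow> (AE x in Pi\<^sub>M I M. avg i (\<lambda>x. F (restrict x U)) x = 0)"
proof -
  have sub: "U - {i} \<subseteq> I"
    using U by auto
  have "(\<lambda>(x, t). x(i := t)) \<in> measurable (Pi\<^sub>M (U - {i}) M \<Otimes>\<^sub>M M i) (Pi\<^sub>M U M)"
    using measurable_add_dim[of i "U - {i}" M] U by (simp add: insert_absorb)
  from measurable_compose[OF this F]
  have "(\<lambda>(x, t). F (x(i := t))) \<in> borel_measurable (Pi\<^sub>M (U - {i}) M \<Otimes>\<^sub>M M i)"
    by (simp add: case_prod_unfold)
  then have [measurable]: "(\<lambda>x. \<integral>t. F (x(i := t)) \<partial>M i) \<in> borel_measurable (Pi\<^sub>M (U - {i}) M)"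
    by (rule M.borel_measurable_lebesgue_integral)
  let ?Q = "\<lambda>x. (\<integral>t. F (x(i := t)) \<partial>M i) = 0"
  have "(AE x in Pi\<^sub>M (U - {i}) M. ?Q x)
     \<longleftrightarrow> (AE x in distr (Pi\<^sub>M I M) (Pi\<^sub>M (U - {i}) M) (\<lambda>x. restrict x (U - {i})). ?Q x)"
    by (simp only: distr_restrict_PiM[OF sub])
  also have "\<dots> \<longleftrightarrow> (AE x in Pi\<^sub>M I M. ?Q (restrict x (U - {i})))"
    by (rule AE_distr_iff[OF measurable_restrict_PiM[OF sub]]) measurable
  also have "\<dots> \<longleftrightarrow> (AE x in Pi\<^sub>M I M. avg i (\<lambda>x. F (restrict x U)) x = 0)"
    by (simp only: avg_def restrict_fun_upd_member[OF U(2)])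
  finally show ?thesis .
qed

lemma determined_by_restrict: "determined_by U (\<lambda>x. F (restrict x U))"
  by (auto simp: determined_by_def intro!: arg_cong[of _ _ F] restrict_ext)

lemma pure_restrict_iff:
  assumes U: "U \<subseteq> I" and F: "F \<in> borel_measurable (Pi\<^sub>M U M)"
  shows "pure U (\<lambda>x. F (restrict x U)) \<longleftrightarrow>
     F \<in> L2 (Pi\<^sub>M U M) \<and> (\<forall>i\<in>U. AE x in Pi\<^sub>M (U - {i}) M. (\<integral>t. F (x(i := t)) \<partial>M i) = 0)"
  using annihilates_iff_avg_eq_0[OF subsetD[OF U]] AE_section_iff[OF U _ F] L2_restrict_iff[OF U F]
  by (auto simp: pure_def determined_by_restrict)

lemma determined_by_factors:
  assumes U: "U \<subseteq> I" and g: "g \<in> borel_measurable (Pi\<^sub>M I M)" and det: "determined_by U g"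
  obtains F where "F \<in> borel_measurable (Pi\<^sub>M U M)"
    "\<And>x. x \<in> space (Pi\<^sub>M I M) \<Longrightarrow> F (restrict x U) = g x"
proof -
  obtain x0 where x0: "x0 \<in> space (Pi\<^sub>M I M)"
    using P.not_empty by blast
  \<comment> \<open>extend a subvector by the coordinates of a fixed point\<close>
  define e where "e = (\<lambda>y. \<lambda>i\<in>I. if i \<in> U then y i else x0 i)"
  have e: "e \<in> measurable (Pi\<^sub>M U M) (Pi\<^sub>M I M)"
    unfolding e_def
  proof (rule measurable_restrict)
    fix i assume "i \<in> I"
    then show "(\<lambda>y. if i \<in> U then y i else x0 i) \<in> measurable (Pi\<^sub>M U M) (M i)"
      using x0 by (cases "i \<in> U") (auto simp: space_PiM PiE_iff intro: measurable_component_singleton)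
  qed
  show ?thesis
  proof
    show "(\<lambda>y. g (e y)) \<in> borel_measurable (Pi\<^sub>M U M)"
      using measurable_compose[OF e g] .
    fix x assume x: "x \<in> space (Pi\<^sub>M I M)"
    have "restrict x U \<in> space (Pi\<^sub>M U M)"
      using measurable_space[OF measurable_restrict_PiM[OF U] x] .
    then have "e (restrict x U) \<in> space (Pi\<^sub>M I M)"
      using measurable_space[OF e] by blast
    then show "g (e (restrict x U)) = g x"
      using x U by (intro determined_byD[OF det]) (auto simp: e_def)
  qed
qed

lemma pure_cong:
  assumes "pure U g" "\<And>x. x \<in> space (Pi\<^sub>M I M) \<Longrightarrow> g x = h x"
  shows "pure U h"
proof -
  have "h \<in> L2 (Pi\<^sub>M I M)"
    using assms measurable_cong[of "Pi\<^sub>M I M" g h]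
      Bochner_Integration.integrable_cong[of "Pi\<^sub>M I M" "Pi\<^sub>M I M" "\<lambda>x. (g x)\<^sup>2" "\<lambda>x. (h x)\<^sup>2"]
    by (auto simp: pure_def L2_def)
  moreover have "annihilates i h" if "annihilates i g" for i
    using that assms(2)
      Bochner_Integration.integral_cong[of "Pi\<^sub>M I M" "Pi\<^sub>M I M" "\<lambda>x. g x * k x" "\<lambda>x. h x * k x" for k]
    by (auto simp: annihilates_def)
  moreover have "determined_by U h"
    using assms unfolding pure_def determined_by_def by metis
  ultimately show ?thesis
    using assms(1) by (simp add: pure_def)
qed

end

section \<open>The Sobol-Hoeffding decomposition\<close>

context
  fixes d :: nat and \<mu> :: "nat \<Rightarrow> real measure"
  assumes prod: "finite_product_prob_space \<mu> {1..d}"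
  notes [simp del] = One_nat_def
begin

interpretation S: finite_product_prob_space \<mu> "{1..d}"
  by (rule prod)

lemma is_sobol_hoeffding_iff_pure:
  assumes F: "\<And>U. U \<subseteq> {1..d} \<Longrightarrow> F U \<in> borel_measurable (Pi\<^sub>M U \<mu>)"
  shows "is_sobol_hoeffding d \<mu> f F \<longleftrightarrow>
     (\<forall>U\<subseteq>{1..d}. S.pure U (\<lambda>x. F U (restrict x U))) \<and>
     (AE x in input_measure d \<mu>. f x = (\<Sum>U\<in>Pow {1..d}. F U (restrict x U))) \<and>
     (\<forall>x. F {} (restrict x {}) = (\<integral>x. f x \<partial>input_measure d \<mu>))"
proof -
  have "(\<forall>U\<subseteq>{1..d}. S.pure U (\<lambda>x. F U (restrict x U))) \<longleftrightarrow>
      (\<forall>U\<subseteq>{1..d}. F U \<in> L2 (Pi\<^sub>M U \<mu>)) \<and>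
      (\<forall>U\<subseteq>{1..d}. \<forall>i\<in>U. AE x in Pi\<^sub>M (U - {i}) \<mu>. (\<integral>t. F U (x(i := t)) \<partial>\<mu> i) = 0)"
    by (simp add: S.pure_restrict_iff[OF _ F] all_conj_distrib imp_conjR)
  then show ?thesis
    unfolding is_sobol_hoeffding_def by argo
qed

lemma ex_is_sobol_hoeffding:
  assumes f: "f \<in> L2 (input_measure d \<mu>)"
  shows "\<exists>F. is_sobol_hoeffding d \<mu> f F"
proof -
  obtain G where G: "\<And>U. U \<subseteq> {1..d} \<Longrightarrow> S.pure U (G U)"
    and f_eq: "\<And>x. f x = (\<Sum>U\<in>Pow {1..d}. G U x)"
    using S.pure_decomposition[OF f] by blast
  have "\<exists>F. F \<in> borel_measurable (Pi\<^sub>M U \<mu>) \<and>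
      (\<forall>x\<in>space (input_measure d \<mu>). F (restrict x U) = G U x)" if "U \<subseteq> {1..d}" for U
  proof -
    have "G U \<in> borel_measurable (input_measure d \<mu>)" "S.determined_by U (G U)"
      using G[OF that] by (auto simp: S.pure_def L2_def)
    from S.determined_by_factors[OF that this] show ?thesis
      by metis
  qed
  then obtain F where F: "\<And>U. U \<subseteq> {1..d} \<Longrightarrow> F U \<in> borel_measurable (Pi\<^sub>M U \<mu>)"
    and FG: "\<And>U x. U \<subseteq> {1..d} \<Longrightarrow> x \<in> space (input_measure d \<mu>) \<Longrightarrow> F U (restrict x U) = G U x"
    by metis
  have pure: "S.pure U (\<lambda>x. F U (restrict x U))" if "U \<subseteq> {1..d}" for U
    using S.pure_cong[OF G[OF that]] FG[OF that] by simp
  have sum: "f x = (\<Sum>U\<in>Pow {1..d}. F U (restrict x U))" if "x \<in> space (input_measure d \<mu>)" for x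
    using FG that by (simp add: f_eq)
  have const: "F {} (restrict x {}) = (\<integral>x. f x \<partial>input_measure d \<mu>)" for x
  proof -
    have "(\<integral>x. f x \<partial>input_measure d \<mu>) = (\<integral>x. (\<Sum>U\<in>Pow {1..d}. F U (restrict x U)) \<partial>input_measure d \<mu>)"
      by (intro Bochner_Integration.integral_cong refl sum)
    also have "\<dots> = (\<Sum>U\<in>Pow {1..d}. \<integral>x. F U (restrict x U) \<partial>input_measure d \<mu>)"
    proof (rule Bochner_Integration.integral_sum)
      fix U assume "U \<in> Pow {1..d}"
      then have L2F: "(\<lambda>x. F U (restrict x U)) \<in> L2 (input_measure d \<mu>)"
        using pure by (simp add: S.pure_def)
      show "integrable (input_measure d \<mu>) (\<lambda>x. F U (restrict x U))"
        using S.P.square_integrable_imp_integrable[OF L2_D, OF L2F L2F] by simp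
    qed
    also have "\<dots> = (\<Sum>U\<in>Pow {1..d}. if U = {} then F {} (\<lambda>x. undefined) else 0)"
    proof (intro sum.cong refl)
      fix U assume "U \<in> Pow {1..d}"
      then show "(\<integral>x. F U (restrict x U) \<partial>input_measure d \<mu>)
          = (if U = {} then F {} (\<lambda>x. undefined) else 0)"
      proof (cases "U = {}")
        case True
        then show ?thesis
          by (simp add: restrict_def S.P.prob_space)
      next
        case False
        then show ?thesis
          using S.integral_pure_eq_0[OF pure False] \<open>U \<in> Pow {1..d}\<close> by simp
      qed
    qed
    also have "\<dots> = F {} (\<lambda>x. undefined)"
      by (simp add: sum.delta)
    finally show ?thesis
      by (simp add: restrict_def)
  qed
  have "is_sobol_hoeffding d \<mu> f F"
    using pure const sum by (subst is_sobol_hoeffding_iff_pure[OF F]) auto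
  then show ?thesis
    by blast
qed

text \<open>The term with index \<open>U\<close> of the decomposition of \<open>f\<close>, as a function on the whole product.\<close>

definition sobol_term :: "((nat \<Rightarrow> real) \<Rightarrow> real) \<Rightarrow> nat set \<Rightarrow> (nat \<Rightarrow> real) \<Rightarrow> real" where
  "sobol_term f U x = sobol_hoeffding d \<mu> f U (restrict x U)"

lemma
  assumes f: "f \<in> L2 (input_measure d \<mu>)"
  shows pure_sobol_term: "U \<subseteq> {1..d} \<Longrightarrow> S.pure U (sobol_term f U)"
    and sum_sobol_term: "AE x in input_measure d \<mu>. f x = (\<Sum>U\<in>Pow {1..d}. sobol_term f U x)"
    and sobol_term_empty: "sobol_term f {} x = (\<integral>x. f x \<partial>input_measure d \<mu>)"
proof -
  have SH: "is_sobol_hoeffding d \<mu> f (sobol_hoeffding d \<mu> f)"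
    unfolding sobol_hoeffding_def using ex_is_sobol_hoeffding[OF f] by (rule someI_ex)
  then have meas: "\<And>U. U \<subseteq> {1..d} \<Longrightarrow> sobol_hoeffding d \<mu> f U \<in> borel_measurable (Pi\<^sub>M U \<mu>)"
    by (auto simp: is_sobol_hoeffding_def L2_def)
  note * = iffD1[OF is_sobol_hoeffding_iff_pure[OF meas] SH]
  show "U \<subseteq> {1..d} \<Longrightarrow> S.pure U (sobol_term f U)"
    using * unfolding sobol_term_def[abs_def] by blast
  show "AE x in input_measure d \<mu>. f x = (\<Sum>U\<in>Pow {1..d}. sobol_term f U x)"
    using * unfolding sobol_term_def by blast
  show "sobol_term f {} x = (\<integral>x. f x \<partial>input_measure d \<mu>)"
    using * unfolding sobol_term_def by blast
qed

lemma L2_sobol_term: "f \<in> L2 (input_measure d \<mu>) \<Longrightarrow> U \<subseteq> {1..d} \<Longrightarrow> sobol_term f U \<in> L2 (input_measure d \<mu>)"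
  using pure_sobol_term by (auto simp: S.pure_def)

lemma variance_sobol_term:
  assumes f: "f \<in> L2 (input_measure d \<mu>)" and U: "U \<subseteq> {1..d}"
  shows "S.P.variance (sobol_term f U) =
    (if U = {} then 0 else (L2_norm (input_measure d \<mu>) (sobol_term f U))\<^sup>2)"
proof (cases "U = {}")
  case True
  have "sobol_term f {} = (\<lambda>x. S.P.expectation f)"
    by (intro ext sobol_term_empty[OF f])
  then show ?thesis
    using True by (simp add: S.P.prob_space)
next
  case False
  then show ?thesis
    using S.integral_pure_eq_0[OF pure_sobol_term[OF f U]] by (simp add: L2_norm_square)
qed

lemma variance_eq_sum_sobol_term:
  assumes f: "f \<in> L2 (input_measure d \<mu>)"
  shows "S.P.variance f =
    (\<Sum>U\<in>Pow {1..d} - {{}}. (L2_norm (input_measure d \<mu>) (sobol_term f U))\<^sup>2)"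
proof -
  \<comment> \<open>the terms of the centred function\<close>
  define H where "H U = (if U = {} then (\<lambda>x. 0) else sobol_term f U)" for U
  have H: "\<And>U. U \<subseteq> {1..d} \<Longrightarrow> S.pure U (H U)"
    using pure_sobol_term[OF f] S.pure_zero by (simp add: H_def)
  have split: "(\<Sum>U\<in>Pow {1..d}. h U) = h {} + (\<Sum>U\<in>Pow {1..d} - {{}}. h U)" for h :: "nat set \<Rightarrow> real"
    by (rule sum.remove) auto
  have "AE x in input_measure d \<mu>. (f x - S.P.expectation f)\<^sup>2 = (\<Sum>U\<in>Pow {1..d}. H U x)\<^sup>2"
    using sum_sobol_term[OF f]
    by eventually_elim (auto simp: split H_def sobol_term_empty[OF f] intro!: sum.cong)
  then have "S.P.variance f = (\<integral>x. (\<Sum>U\<in>Pow {1..d}. H U x)\<^sup>2 \<partial>input_measure d \<mu>)"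
    using L2_D(1)[OF f] H
    by (intro integral_cong_AE borel_measurable_power borel_measurable_diff borel_measurable_sum)
       (auto simp: S.pure_def L2_def)
  also have "\<dots> = (\<Sum>U\<in>Pow {1..d}. (L2_norm (input_measure d \<mu>) (H U))\<^sup>2)"
    using S.pure_Parseval[OF H] by (simp add: L2_norm_square)
  also have "\<dots> = (\<Sum>U\<in>Pow {1..d} - {{}}. (L2_norm (input_measure d \<mu>) (sobol_term f U))\<^sup>2)"
    by (auto simp: split H_def L2_norm_def intro!: sum.cong)
  finally show ?thesis .
qed

lemma sum_diff_L2_norm_sobol_term_le:
  assumes f: "f \<in> L2 (input_measure d \<mu>)" and g: "g \<in> L2 (input_measure d \<mu>)"
  shows "(\<Sum>U\<in>Pow {1..d} - {{}}. (L2_norm (input_measure d \<mu>) (sobol_term f U)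
             - L2_norm (input_measure d \<mu>) (sobol_term g U))\<^sup>2)
         \<le> (L2_norm (input_measure d \<mu>) (\<lambda>x. f x - g x))\<^sup>2"
proof -
  let ?N = "input_measure d \<mu>"
  define H where "H U x = sobol_term f U x - sobol_term g U x" for U x
  have H: "\<And>U. U \<subseteq> {1..d} \<Longrightarrow> S.pure U (H U)"
    using S.pure_diff[OF pure_sobol_term[OF f] pure_sobol_term[OF g]] by (simp add: H_def[abs_def])
  have "(\<Sum>U\<in>Pow {1..d} - {{}}. (L2_norm ?N (sobol_term f U) - L2_norm ?N (sobol_term g U))\<^sup>2)
      \<le> (\<Sum>U\<in>Pow {1..d}. (L2_norm ?N (sobol_term f U) - L2_norm ?N (sobol_term g U))\<^sup>2)"
    by (intro sum_mono2) auto
  also have "\<dots> \<le> (\<Sum>U\<in>Pow {1..d}. \<integral>x. (H U x)\<^sup>2 \<partial>?N)"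
    unfolding H_def by (intro sum_mono L2_norm_diff_ge) (auto intro: L2_sobol_term f g)
  also have "\<dots> = (\<integral>x. (\<Sum>U\<in>Pow {1..d}. H U x)\<^sup>2 \<partial>?N)"
    using S.pure_Parseval[OF H] by simp
  also have "\<dots> = (\<integral>x. (f x - g x)\<^sup>2 \<partial>?N)"
  proof (rule integral_cong_AE)
    show "AE x in ?N. (\<Sum>U\<in>Pow {1..d}. H U x)\<^sup>2 = (f x - g x)\<^sup>2"
      using sum_sobol_term[OF f] sum_sobol_term[OF g]
      by eventually_elim (simp add: H_def sum_subtractf)
    show "(\<lambda>x. (\<Sum>U\<in>Pow {1..d}. H U x)\<^sup>2) \<in> borel_measurable ?N"
      using H by (intro borel_measurable_power borel_measurable_sum) (auto simp: S.pure_def L2_def)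
    show "(\<lambda>x. (f x - g x)\<^sup>2) \<in> borel_measurable ?N"
      using L2_D(1)[OF f] L2_D(1)[OF g] by simp
  qed
  finally show ?thesis
    by (simp add: L2_norm_square)
qed

text \<open>For empty \<open>U\<close> the sum is empty, in agreement with the index 0 of a constant term.\<close>

lemma sobol_index_eq:
  assumes f: "f \<in> L2 (input_measure d \<mu>)" and U: "U \<subseteq> {1..d}"
  shows "sobol_index d \<mu> f U =
    (\<Sum>V\<in>{U} - {{}}. (L2_norm (input_measure d \<mu>) (sobol_term f V))\<^sup>2) / S.P.variance f"
  using variance_sobol_term[OF f U]
  by (cases "U = {}") (simp_all add: sobol_index_def sobol_term_def[abs_def])

lemma total_effect_index_eq:
  assumes f: "f \<in> L2 (input_measure d \<mu>)"
  shows "total_effect_index d \<mu> f U =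
    (\<Sum>V | V \<subseteq> {1..d} \<and> V \<inter> U \<noteq> {}. (L2_norm (input_measure d \<mu>) (sobol_term f V))\<^sup>2)
      / S.P.variance f"
  unfolding total_effect_index_def sum_divide_distrib
proof (intro sum.cong refl)
  fix V assume "V \<in> {V. V \<subseteq> {1..d} \<and> V \<inter> U \<noteq> {}}"
  then have "V \<subseteq> {1..d}" "{V} - {{}} = {V}"
    by auto
  then show "sobol_index d \<mu> f V = (L2_norm (input_measure d \<mu>) (sobol_term f V))\<^sup>2 / S.P.variance f"
    using sobol_index_eq[OF f, of V] by simp
qed

end

section \<open>Two unit vectors in the plane\<close>

lemma unit_vectors_square_diff:
  fixes a b p q :: real
  assumes "a \<ge> 0" "b \<ge> 0" and ab: "a\<^sup>2 + b\<^sup>2 = 1" and pq: "p\<^sup>2 + q\<^sup>2 = 1"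
  defines "s \<equiv> a * q - b * p"
  shows "\<bar>a\<^sup>2 - p\<^sup>2\<bar> \<le> \<bar>s\<bar>" "\<bar>a\<^sup>2 - p\<^sup>2\<bar> \<le> (\<bar>s\<bar> + 2 * a) * \<bar>s\<bar>"
    "\<bar>a\<^sup>2 - p\<^sup>2\<bar> \<le> (\<bar>s\<bar> + 2 * b) * \<bar>s\<bar>"
proof -
  \<comment> \<open>For \<open>(a, b) = (sin \<alpha>, cos \<alpha>)\<close> and \<open>(p, q) = (sin \<beta>, cos \<beta>)\<close> the numbers \<open>s\<close>, \<open>c\<close>, \<open>r\<close> are
    \<open>sin (\<alpha> - \<beta>)\<close>, \<open>cos (\<alpha> - \<beta>)\<close>, \<open>sin (\<alpha> + \<beta>)\<close>.\<close>
  define c r where "c = a * p + b * q" and "r = a * q + b * p"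
  have "s\<^sup>2 + c\<^sup>2 = (a\<^sup>2 + b\<^sup>2) * (p\<^sup>2 + q\<^sup>2)"
    by (simp add: s_def c_def power2_eq_square algebra_simps)
  then have "s\<^sup>2 + c\<^sup>2 = 1"
    using ab pq by simp
  then have c: "\<bar>c\<bar> \<le> 1"
    unfolding abs_square_le_1[symmetric] using zero_le_power2[of s] by linarith
  have "r\<^sup>2 + (a * p - b * q)\<^sup>2 = (a\<^sup>2 + b\<^sup>2) * (p\<^sup>2 + q\<^sup>2)"
    by (simp add: r_def power2_eq_square algebra_simps)
  then have "r\<^sup>2 + (a * p - b * q)\<^sup>2 = 1"
    using ab pq by simp
  then have r: "\<bar>r\<bar> \<le> 1"
    unfolding abs_square_le_1[symmetric] using zero_le_power2[of "a * p - b * q"] by linarith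
  have le1: "a \<le> 1" "b \<le> 1"
  proof -
    have "a\<^sup>2 \<le> 1\<^sup>2" "b\<^sup>2 \<le> 1\<^sup>2"
      using ab zero_le_power2[of a] zero_le_power2[of b] unfolding one_power2 by linarith+
    then show "a \<le> 1" "b \<le> 1"
      by (auto intro: power2_le_imp_le)
  qed
  have "r = (a\<^sup>2 + b\<^sup>2) * r"
    using ab by simp
  also have "\<dots> = 2 * (a * b * c) + (a\<^sup>2 - b\<^sup>2) * s"
    by (simp add: r_def c_def s_def power2_eq_square algebra_simps)
  finally have r_eq: "r = 2 * (a * b * c) + (a\<^sup>2 - b\<^sup>2) * s" .
  have "\<bar>a\<^sup>2 - b\<^sup>2\<bar> \<le> 1"
    using ab zero_le_power2[of a] zero_le_power2[of b] by linarith
  then have s_term: "\<bar>(a\<^sup>2 - b\<^sup>2) * s\<bar> \<le> \<bar>s\<bar>"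
    by (simp add: abs_mult mult_left_le_one_le)
  have "\<bar>a * b * c\<bar> \<le> a * b"
    using assms(1,2) c by (simp add: abs_mult mult_left_le)
  moreover have "a * b \<le> a" "a * b \<le> b"
    using assms(1,2) le1 by (simp_all add: mult_left_le mult_left_le_one_le)
  ultimately have r2: "\<bar>r\<bar> \<le> \<bar>s\<bar> + 2 * a" "\<bar>r\<bar> \<le> \<bar>s\<bar> + 2 * b"
    using s_term unfolding r_eq by linarith+
  have "a\<^sup>2 - p\<^sup>2 = a\<^sup>2 * (p\<^sup>2 + q\<^sup>2) - p\<^sup>2 * (a\<^sup>2 + b\<^sup>2)"
    using ab pq by simp
  also have "\<dots> = r * s"
    by (simp add: r_def s_def power2_eq_square algebra_simps)
  finally have *: "\<bar>a\<^sup>2 - p\<^sup>2\<bar> = \<bar>r\<bar> * \<bar>s\<bar>"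
    by (simp add: abs_mult)
  show "\<bar>a\<^sup>2 - p\<^sup>2\<bar> \<le> \<bar>s\<bar>"
    unfolding * using r by (simp add: mult_left_le_one_le)
  show "\<bar>a\<^sup>2 - p\<^sup>2\<bar> \<le> (\<bar>s\<bar> + 2 * a) * \<bar>s\<bar>" "\<bar>a\<^sup>2 - p\<^sup>2\<bar> \<le> (\<bar>s\<bar> + 2 * b) * \<bar>s\<bar>"
    unfolding * using r2 by (simp_all add: mult_right_mono)
qed

text \<open>
  The finite-dimensional form of the bound: \<open>S\<close> and \<open>T\<close> are the shares of the coordinates in \<open>A\<close> in
  the squared lengths of \<open>x\<close> and \<open>y\<close>.
\<close>

lemma share_diff_bound:
  fixes x y :: "'a \<Rightarrow> real" and E :: real
  assumes fin: "finite N" and A: "A \<subseteq> N"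
    and X: "X = (\<Sum>n\<in>N. (x n)\<^sup>2)" "X > 0" and Y: "Y = (\<Sum>n\<in>N. (y n)\<^sup>2)" "Y > 0"
    and E: "E \<ge> 0" "(\<Sum>n\<in>N. (x n - y n)\<^sup>2) \<le> E\<^sup>2 * X"
    and S: "S = (\<Sum>n\<in>A. (x n)\<^sup>2) / X" and T: "T = (\<Sum>n\<in>A. (y n)\<^sup>2) / Y"
  shows "\<bar>S - T\<bar> \<le> Min {1, E + 2 * sqrt S, E + 2 * sqrt (1 - S)} * E"
    and "S \<in> {0, 1} \<Longrightarrow> \<bar>S - T\<bar> \<le> E\<^sup>2"
proof -
  have split: "(\<Sum>n\<in>N. h n) = (\<Sum>n\<in>A. h n) + (\<Sum>n\<in>N - A. h n)" for h :: "'a \<Rightarrow> real"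
    using sum.subset_diff[OF A fin, of h] by simp
  have compl: "1 - S = (\<Sum>n\<in>N - A. (x n)\<^sup>2) / X" "1 - T = (\<Sum>n\<in>N - A. (y n)\<^sup>2) / Y"
    using X Y by (simp_all add: S T split field_simps)
  have nonneg: "S \<ge> 0" "1 - S \<ge> 0" "T \<ge> 0" "1 - T \<ge> 0"
    unfolding compl unfolding S T using X(2) Y(2) by (auto intro!: divide_nonneg_pos sum_nonneg)
  define a b p q where "a = sqrt S" "b = sqrt (1 - S)" "p = sqrt T" "q = sqrt (1 - T)"
  note abpq = this
  have sq: "a\<^sup>2 = S" "b\<^sup>2 = 1 - S" "p\<^sup>2 = T" "q\<^sup>2 = 1 - T"
    using nonneg by (simp_all add: abpq)
  have CS: "(\<Sum>n\<in>B. x n * y n) \<le> sqrt (\<Sum>n\<in>B. (x n)\<^sup>2) * sqrt (\<Sum>n\<in>B. (y n)\<^sup>2)" for B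
    using Cauchy_Schwarz_ineq_sum[of x y B] by (simp add: real_le_rsqrt flip: real_sqrt_mult)
  have sums: "(\<Sum>n\<in>A. (x n)\<^sup>2) = X * S" "(\<Sum>n\<in>A. (y n)\<^sup>2) = Y * T"
    "(\<Sum>n\<in>N - A. (x n)\<^sup>2) = X * (1 - S)" "(\<Sum>n\<in>N - A. (y n)\<^sup>2) = Y * (1 - T)"
    unfolding compl unfolding S T using X(2) Y(2) by simp_all
  have "(\<Sum>n\<in>N. x n * y n) \<le> sqrt (X * S) * sqrt (Y * T) + sqrt (X * (1 - S)) * sqrt (Y * (1 - T))"
    using CS[of A] CS[of "N - A"] unfolding split[of "\<lambda>n. x n * y n"] sums by linarith
  also have "\<dots> = sqrt X * sqrt Y * (a * p + b * q)"
    by (simp only: abpq real_sqrt_mult) (simp add: algebra_simps)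
  finally have inner: "(\<Sum>n\<in>N. x n * y n) \<le> sqrt X * sqrt Y * (a * p + b * q)" .
  \<comment> \<open>The square of the distance between \<open>\<surd>X (a, b)\<close> and \<open>\<surd>Y (p, q)\<close> is the sum of the square of
    the distance of the former to the line through the latter and of a square along that line.\<close>
  have "X * (a * q - b * p)\<^sup>2 \<le> X * (a * q - b * p)\<^sup>2 + (sqrt Y - sqrt X * (a * p + b * q))\<^sup>2"
    by simp
  also have "\<dots> = X * ((a\<^sup>2 + b\<^sup>2) * (p\<^sup>2 + q\<^sup>2)) + Y - 2 * (sqrt X * sqrt Y * (a * p + b * q))"
  proof -
    have "(sqrt Y - sqrt X * (a * p + b * q))\<^sup>2
        = Y + X * (a * p + b * q)\<^sup>2 - 2 * (sqrt X * sqrt Y * (a * p + b * q))"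
      using X(2) Y(2) by (simp add: power2_diff power_mult_distrib)
    moreover have "X * (a * q - b * p)\<^sup>2 + X * (a * p + b * q)\<^sup>2 = X * ((a\<^sup>2 + b\<^sup>2) * (p\<^sup>2 + q\<^sup>2))"
      by (simp add: power2_eq_square algebra_simps)
    ultimately show ?thesis
      by linarith
  qed
  also have "\<dots> \<le> X + Y - 2 * (\<Sum>n\<in>N. x n * y n)"
    using inner by (simp add: sq)
  also have "\<dots> = (\<Sum>n\<in>N. (x n - y n)\<^sup>2)"
    by (simp add: X(1) Y(1) power2_diff sum.distrib sum_subtractf sum_distrib_left mult.assoc)
  also have "\<dots> \<le> X * E\<^sup>2"
    using E(2) by (simp add: mult.commute)
  finally have sE: "\<bar>a * q - b * p\<bar> \<le> E"
    using X(2) E(1) abs_le_square_iff[of "a * q - b * p" E] by simp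
  have ab0: "a \<ge> 0" "b \<ge> 0"
    using nonneg by (simp_all add: abpq)
  note bounds = unit_vectors_square_diff[OF ab0, of p q, unfolded sq, simplified]
  have b1: "\<bar>S - T\<bar> \<le> 1 * E"
    using bounds(1) sE by linarith
  have b2: "\<bar>S - T\<bar> \<le> (E + 2 * a) * E"
    using order_trans[OF bounds(2) mult_mono[of _ "E + 2 * a" _ E]] sE E(1) ab0 by simp
  have b3: "\<bar>S - T\<bar> \<le> (E + 2 * b) * E"
    using order_trans[OF bounds(3) mult_mono[of _ "E + 2 * b" _ E]] sE E(1) ab0 by simp
  show "\<bar>S - T\<bar> \<le> Min {1, E + 2 * sqrt S, E + 2 * sqrt (1 - S)} * E"
    using b1 b2 b3 by (simp add: abpq min_def)
  show "\<bar>S - T\<bar> \<le> E\<^sup>2" if "S \<in> {0, 1}"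
    using that b2 b3 by (auto simp: abpq power2_eq_square)
qed

section \<open>The bound for the indices\<close>

lemma index_diff_bound:
  fixes d :: nat and \<mu> :: "nat \<Rightarrow> real measure"
  assumes prod: "finite_product_prob_space \<mu> {1..d}"
    and f: "f \<in> L2 (input_measure d \<mu>)" and g: "g \<in> L2 (input_measure d \<mu>)"
    and f_pos: "prob_space.variance (input_measure d \<mu>) f > 0"
    and g_pos: "prob_space.variance (input_measure d \<mu>) g > 0"
    and ind: "ind = sobol_index d \<mu> \<or> ind = total_effect_index d \<mu>"
    and U: "U \<subseteq> {1..d}"
  defines "E \<equiv> relative_error d \<mu> f g"
  shows "\<bar>ind f U - ind g U\<bar> \<le> Min {1, E + 2 * sqrt (ind f U), E + 2 * sqrt (1 - ind f U)} * E"
    and "ind f U \<in> {0, 1} \<Longrightarrow> \<bar>ind f U - ind g U\<bar> \<le> E\<^sup>2"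
proof -
  let ?N = "input_measure d \<mu>"
  let ?x = "\<lambda>V. L2_norm ?N (sobol_term d \<mu> f V)"
  let ?y = "\<lambda>V. L2_norm ?N (sobol_term d \<mu> g V)"
  obtain A where A: "A \<subseteq> Pow {1..d} - {{}}"
    and ind_eq: "\<And>h. h \<in> L2 ?N \<Longrightarrow>
      ind h U = (\<Sum>V\<in>A. (L2_norm ?N (sobol_term d \<mu> h V))\<^sup>2) / prob_space.variance ?N h"
    using ind
  proof
    assume "ind = sobol_index d \<mu>"
    then show ?thesis
      using that[of "{U} - {{}}"] sobol_index_eq[OF prod _ U] U by auto
  next
    assume "ind = total_effect_index d \<mu>"
    then show ?thesis
      using that[of "{V. V \<subseteq> {1..d} \<and> V \<inter> U \<noteq> {}}"] total_effect_index_eq[OF prod] by auto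
  qed
  have "E\<^sup>2 * prob_space.variance ?N f = (L2_norm ?N (\<lambda>x. f x - g x))\<^sup>2"
    using f_pos by (simp add: E_def relative_error_def power_divide)
  then have E: "(\<Sum>V\<in>Pow {1..d} - {{}}. (?x V - ?y V)\<^sup>2) \<le> E\<^sup>2 * prob_space.variance ?N f"
    using sum_diff_L2_norm_sobol_term_le[OF prod f g] by simp
  have E0: "E \<ge> 0"
    using f_pos by (simp add: E_def relative_error_def L2_norm_nonneg)
  have fin: "finite (Pow {1..d} - {{}})"
    by simp
  note * = share_diff_bound[OF fin A variance_eq_sum_sobol_term[OF prod f] f_pos
      variance_eq_sum_sobol_term[OF prod g] g_pos E0 E ind_eq[OF f] ind_eq[OF g]]
  show "\<bar>ind f U - ind g U\<bar> \<le> Min {1, E + 2 * sqrt (ind f U), E + 2 * sqrt (1 - ind f U)} * E"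
    by (rule *(1))
  show "ind f U \<in> {0, 1} \<Longrightarrow> \<bar>ind f U - ind g U\<bar> \<le> E\<^sup>2"
    by (rule *(2))
qed

lemma is_sobol_hoeffding_cong:
  assumes "\<And>i. i \<in> {1..d} \<Longrightarrow> \<mu> i = \<nu> i"
  shows "is_sobol_hoeffding d \<mu> f F = is_sobol_hoeffding d \<nu> f F"
proof -
  have eq: "Pi\<^sub>M U \<mu> = Pi\<^sub>M U \<nu>" if "U \<subseteq> {1..d}" for U
    using that assms by (intro PiM_cong) auto
  have "(\<forall>U\<subseteq>{1..d}. F U \<in> L2 (Pi\<^sub>M U \<mu>)) \<longleftrightarrow> (\<forall>U\<subseteq>{1..d}. F U \<in> L2 (Pi\<^sub>M U \<nu>))"
    using eq by auto
  moreover have "(AE x in Pi\<^sub>M (U - {i}) \<mu>. (\<integral>t. F U (x(i := t)) \<partial>\<mu> i) = 0) \<longleftrightarrow>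
      (AE x in Pi\<^sub>M (U - {i}) \<nu>. (\<integral>t. F U (x(i := t)) \<partial>\<nu> i) = 0)"
    if "U \<subseteq> {1..d}" "i \<in> U" for U i
  proof -
    have "U - {i} \<subseteq> {1..d}" "i \<in> {1..d}"
      using that by auto
    then show ?thesis
      by (simp only: eq assms)
  qed
  then have "(\<forall>U\<subseteq>{1..d}. \<forall>i\<in>U. AE x in Pi\<^sub>M (U - {i}) \<mu>. (\<integral>t. F U (x(i := t)) \<partial>\<mu> i) = 0) \<longleftrightarrow>
      (\<forall>U\<subseteq>{1..d}. \<forall>i\<in>U. AE x in Pi\<^sub>M (U - {i}) \<nu>. (\<integral>t. F U (x(i := t)) \<partial>\<nu> i) = 0)"
    by blast
  ultimately show ?thesis
    unfolding is_sobol_hoeffding_def eq[OF order_refl] by argo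
qed

theorem corollary1:
  fixes d :: nat
    and X :: "nat \<Rightarrow> real set"
    and \<mu> :: "nat \<Rightarrow> real measure"
    and f fh :: "(nat \<Rightarrow> real) \<Rightarrow> real"
    and ind :: "((nat \<Rightarrow> real) \<Rightarrow> real) \<Rightarrow> nat set \<Rightarrow> real"
    and \<E> :: real
    and U :: "nat set"
  assumes "\<And>i. i \<in> {1..d} \<Longrightarrow> prob_space (\<mu> i)"
    and "\<And>i. i \<in> {1..d} \<Longrightarrow> sets (\<mu> i) = sets (restrict_space borel (X i))"
    and "f \<in> L2 (input_measure d \<mu>)"
    and "fh \<in> L2 (input_measure d \<mu>)"
    and "prob_space.variance (input_measure d \<mu>) f > 0"
    and "prob_space.variance (input_measure d \<mu>) fh > 0"
    and "\<E> = relative_error d \<mu> f fh"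
    and "ind = sobol_index d \<mu> \<or> ind = total_effect_index d \<mu>"
    and "U \<subseteq> {1..d}"
  shows "\<bar>ind f U - ind fh U\<bar>
           \<le> Min {1, \<E> + 2 * sqrt (ind f U), \<E> + 2 * sqrt (1 - ind f U)} * \<E>
         \<and> (ind f U \<in> {0, 1} \<longrightarrow> \<bar>ind f U - ind fh U\<bar> \<le> \<E>\<^sup>2)"
proof -
  \<comment> \<open>The measures outside \<open>{1..d}\<close> do not enter the statement; they are replaced so that every
    measure of the family is a probability measure.\<close>
  define \<nu> where "\<nu> i = (if i \<in> {1..d} then \<mu> i else return borel 0)" for i
  have eq: "\<mu> i = \<nu> i" if "i \<in> {1..d}" for i
    using that by (simp add: \<nu>_def)
  have prob: "prob_space (\<nu> i)" for i
    using assms(1) by (auto simp: \<nu>_def intro: prob_space_return)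
  have prod: "finite_product_prob_space \<nu> {1..d}"
    using prob by (auto simp: finite_product_prob_space_def finite_product_sigma_finite_def
        product_prob_space_def product_prob_space_axioms_def product_sigma_finite_def
        finite_product_sigma_finite_axioms_def intro: prob_space_imp_sigma_finite)
  have N: "input_measure d \<mu> = input_measure d \<nu>"
    using eq by (rule PiM_cong[OF refl])
  have SH: "is_sobol_hoeffding d \<mu> = is_sobol_hoeffding d \<nu>"
    by (intro ext is_sobol_hoeffding_cong eq)
  have index: "sobol_index d \<mu> = sobol_index d \<nu>"
    unfolding sobol_index_def[abs_def] sobol_hoeffding_def SH N ..
  have total: "total_effect_index d \<mu> = total_effect_index d \<nu>"
    unfolding total_effect_index_def[abs_def] index ..
  have error: "\<E> = relative_error d \<nu> f fh"
    unfolding assms(7) relative_error_def N ..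
  note * = index_diff_bound[OF prod assms(3-6)[unfolded N] assms(8)[unfolded index total] assms(9),
      folded error]
  show ?thesis
    using * by blast
qed

end
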